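(* Let $\mathfrak g=\mathfrak{gl}_{n+1}(\mathbb C)$ with trace pairing $\langle a,b\rangle=\mathrm{tr}(ab)$. For $\tau\in\mathfrak g$ let $\tau_H\in\mathfrak g$ be obtained by replacing the last row and last column of $\tau$ by zeros, let $1_H=\mathrm{diag}(1,\dots,1,0)$, and set $\tau_H^j:=1_H(\tau_H)^j$ for $j\ge0$ (so $\tau_H^0=1_H$). Let $D(\tau)$ be the $n\times n$ matrix with entries $D(\tau)_{ij}=\langle[1_H,[\tau^i,\tau_H^{j-1}]],\tau\rangle$ ($1\le i,j\le n$) and $\Delta(\tau)=\det D(\tau)$. Let $\lambda_1,\dots,\lambda_{n+1}$ be the eigenvalues of $\tau$ and $\mu_1,\dots,\mu_n$ those of the upper-left $n\times n$ block of $\tau$ (with multiplicity), and $\Delta_0(\tau)=\prod_{i=1}^{n+1}\prod_{j=1}^n(\lambda_i-\mu_j)$. Then for all $\tau\in\mathfrak g$, \[\Delta(\tau)=2^n(-1)^{n(n-1)/2}\Delta_0(\tau).\] *)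

theory Defs
  imports
    "Jordan_Normal_Form.Char_Poly"
    "HOL-Computational_Algebra.Fundamental_Theorem_Algebra"
begin

text \<open>
  Matrices are the dimension-carrying matrices of \<^typ>\<open>'a mat\<close>, whose indices start at 0; so
  \<open>gl\<^bsub>n+1\<^esub>(\<complex>)\<close> is \<open>carrier_mat (n + 1) (n + 1)\<close>, and the last row and column
  have index \<open>n\<close>.
\<close>

definition mat_trace :: "'a :: comm_monoid_add mat \<Rightarrow> 'a" where
  "mat_trace A = (\<Sum>i<dim_row A. A $$ (i, i))"

definition trace_pairing :: "complex mat \<Rightarrow> complex mat \<Rightarrow> complex" where
  "trace_pairing A B = mat_trace (A * B)"

definition mat_bracket :: "complex mat \<Rightarrow> complex mat \<Rightarrow> complex mat" where
  "mat_bracket A B = A * B - B * A"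

definition H_part :: "nat \<Rightarrow> complex mat \<Rightarrow> complex mat" where
  "H_part n \<tau> = mat (n + 1) (n + 1) (\<lambda>(i, j). if i = n \<or> j = n then 0 else \<tau> $$ (i, j))"

definition H_one :: "nat \<Rightarrow> complex mat" where
  "H_one n = mat (n + 1) (n + 1) (\<lambda>(i, j). if i = j \<and> i < n then 1 else 0)"

definition H_pow :: "nat \<Rightarrow> complex mat \<Rightarrow> nat \<Rightarrow> complex mat" where
  "H_pow n \<tau> j = H_one n * (H_part n \<tau> ^\<^sub>m j)"

definition upper_left :: "nat \<Rightarrow> complex mat \<Rightarrow> complex mat" where
  "upper_left n \<tau> = mat n n (\<lambda>(i, j). \<tau> $$ (i, j))"

definition D_entry :: "nat \<Rightarrow> complex mat \<Rightarrow> nat \<Rightarrow> nat \<Rightarrow> complex" where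
  "D_entry n \<tau> i j =
     trace_pairing (mat_bracket (H_one n) (mat_bracket (\<tau> ^\<^sub>m i) (H_pow n \<tau> (j - 1)))) \<tau>"

text \<open>The entries are indexed by \<open>1 \<le> i, j \<le> n\<close>, hence the index shift.\<close>

definition D_mat :: "nat \<Rightarrow> complex mat \<Rightarrow> complex mat" where
  "D_mat n \<tau> = mat n n (\<lambda>(i, j). D_entry n \<tau> (i + 1) (j + 1))"

definition Delta :: "nat \<Rightarrow> complex mat \<Rightarrow> complex" where
  "Delta n \<tau> = det (D_mat n \<tau>)"

text \<open>Eigenvalues with algebraic multiplicity.\<close>

definition eigenvalues_mset :: "complex mat \<Rightarrow> complex multiset" where
  "eigenvalues_mset A = proots (char_poly A)"

lemma set_eigenvalues_mset:
  assumes "A \<in> carrier_mat m m"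
  shows "set_mset (eigenvalues_mset A) = {k. eigenvalue A k}"
proof -
  have "char_poly A \<noteq> 0"
    using degree_monic_char_poly[OF assms] by auto
  then show ?thesis
    using eigenvalue_root_char_poly[OF assms] by (simp add: eigenvalues_mset_def)
qed

lemma size_eigenvalues_mset:
  assumes "A \<in> carrier_mat m m"
  shows "size (eigenvalues_mset A) = m"
  using degree_monic_char_poly[OF assms]
  by (simp add: eigenvalues_mset_def size_proots_complex)

definition Delta0 :: "nat \<Rightarrow> complex mat \<Rightarrow> complex" where
  "Delta0 n \<tau> =
     (\<Prod>l \<in># eigenvalues_mset \<tau>. \<Prod>m \<in># eigenvalues_mset (upper_left n \<tau>). l - m)"

end

theory Submission
  imports Defs
begin

text \<open>
  Write \<open>\<tau>\<close> in blocks with upper left block \<open>A\<close>, last column \<open>B\<close>, last row \<open>C\<close> and corner \<open>d\<close>,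
  and let \<open>h\<^sub>k = C A\<^sup>k B\<close>. Computing the brackets blockwise and expanding the last row and column of
  \<open>\<tau>\<^sup>i\<close> in terms of lower powers shows that \<open>D(\<tau>)\<close> is \<open>-2\<close> times a unit lower triangular matrix
  times the Hankel matrix of \<open>h\<close>.

  The Hankel matrix is the Gram matrix, in the monomial basis, of the form \<open>\<phi>(p q)\<close>, where
  \<open>\<phi>(p) = C p(A) B\<close>. Let \<open>\<chi>\<close> be the characteristic polynomial of \<open>A\<close>. In the Newton basis
  \<open>\<Prod>\<^bsub>j<k\<^esub> (x - \<mu>\<^sub>j)\<close> on one side and the Newton basis for the reversed list of roots on the
  other, the Gram matrix is triangular with respect to the antidiagonal, since \<open>\<phi>\<close> kills all
  multiples of \<open>\<chi>\<close>, and its antidiagonal entries are \<open>\<phi>(\<chi> / (x - \<mu>\<^sub>k))\<close>.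

  Finally \<open>\<phi>(\<chi> / (x - \<mu>\<^sub>k))\<close> is the value at \<open>\<mu>\<^sub>k\<close> of \<open>C adj(x - A) B\<close>, which is minus the value
  of the characteristic polynomial of \<open>\<tau>\<close>. Both facts about \<open>\<phi>\<close> come from the recurrence
  \<open>x R\<^sub>k - R\<^bsub>k+1\<^esub> = h\<^sub>k \<chi>\<close> for \<open>R\<^sub>k = C A\<^sup>k adj(x - A) B\<close>, by telescoping along coefficients; this
  replaces the Cayley-Hamilton theorem.
\<close>

subsection \<open>Linear functionals on polynomials and Hankel determinants\<close>

text \<open>The linear functional sending \<open>x^l\<close> to \<open>h l\<close>, the
  \<open>\<phi>\<close> of the overview. Working with an arbitrary sequence turns multiplication by
  \<open>x\<close> into a shift of \<open>h\<close>.\<close>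

definition seq_functional :: "(nat \<Rightarrow> 'a :: comm_ring_1) \<Rightarrow> 'a poly \<Rightarrow> 'a" where
  "seq_functional h p = (\<Sum>l\<le>degree p. coeff p l * h l)"

lemma seq_functional_upto:
  assumes "degree p \<le> N"
  shows "seq_functional h p = (\<Sum>l\<le>N. coeff p l * h l)"
  unfolding seq_functional_def using assms
  by (intro sum.mono_neutral_left) (auto simp: coeff_eq_0)

lemma seq_functional_add:
  "seq_functional h (p + q) = seq_functional h p + seq_functional h q"
proof -
  define N where "N = max (degree p) (degree q)"
  have "degree (p + q) \<le> N" "degree p \<le> N" "degree q \<le> N"
    by (auto simp: N_def degree_add_le_max)
  then show ?thesis
    by (simp add: seq_functional_upto[where N = N] sum.distrib algebra_simps)
qed

lemma seq_functional_smult: "seq_functional h (Polynomial.smult a p) = a * seq_functional h p"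
proof -
  have "degree (Polynomial.smult a p) \<le> degree p" by (rule degree_smult_le)
  then show ?thesis
    by (simp add: seq_functional_upto[where N = "degree p"] sum_distrib_left mult.assoc)
qed

lemma seq_functional_pCons:
  "seq_functional h (pCons a p) = a * h 0 + seq_functional (\<lambda>i. h (Suc i)) p"
proof -
  have "degree (pCons a p) \<le> Suc (degree p)" by (rule degree_pCons_le)
  then show ?thesis
    by (simp add: seq_functional_upto[where N = "Suc (degree p)"] seq_functional_def
        sum.atMost_Suc_shift del: sum.atMost_Suc)
qed

lemma seq_functional_0 [simp]: "seq_functional h 0 = 0"
  by (simp add: seq_functional_def)

text \<open>Both sides are the double sum of \<open>p_i q_j h (i + j)\<close>. The induction varies
  \<open>h\<close>, because peeling off the constant coefficient of \<open>p\<close> shifts the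
  sequence.\<close>

lemma seq_functional_mult:
  "seq_functional h (p * q) = seq_functional (\<lambda>i. seq_functional (\<lambda>j. h (i + j)) q) p"
proof (induction p arbitrary: h)
  case 0
  then show ?case by simp
next
  case (pCons a p)
  have "seq_functional h (pCons a p * q)
      = a * seq_functional h q + seq_functional (\<lambda>i. h (Suc i)) (p * q)"
    by (simp add: seq_functional_add seq_functional_smult seq_functional_pCons)
  then show ?case
    by (simp add: pCons.IH seq_functional_pCons)
qed

text \<open>Comparing coefficient \<open>l\<close> in the relation for \<open>k = l\<close> gives
  \<open>g_l * h l\<close> as a difference of neighbouring diagonal coefficients, apart from
  \<open>r 0\<close> at \<open>l = 0\<close>. Bounded degrees make the far end of the telescope
  vanish.\<close>

lemma seq_functional_telescope:
  fixes U :: "nat \<Rightarrow> 'a :: comm_ring_1 poly"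
  assumes step: "\<And>k. pCons 0 (U k) - U (Suc k) = Polynomial.smult (h k) g - [:r k:]"
    and bound: "\<And>k. degree (U k) \<le> N"
  shows "seq_functional h g = r 0"
proof -
  define M where "M = Suc (max N (degree g))"
  have coeffs: "coeff (pCons 0 (U l)) l - coeff (U (Suc l)) l
      = coeff g l * h l - (if l = 0 then r 0 else 0)" for l
    using arg_cong[OF step[of l], of "\<lambda>p. coeff p l"]
    by (cases l) (simp_all add: mult.commute)
  \<comment> \<open>Coefficient \<open>l\<close> of \<open>U (Suc l)\<close> is rewritten as
    coefficient \<open>Suc l\<close> of \<open>x\<close> times it, so that both terms come from one
    function of \<open>l\<close>.\<close>
  have "(\<Sum>l\<le>M. coeff g l * h l - (if l = 0 then r 0 else 0))
      = (\<Sum>l\<le>M. coeff (pCons 0 (U l)) l - coeff (pCons 0 (U (Suc l))) (Suc l))"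
    by (simp flip: coeffs)
  also have "\<dots> = - coeff (U (Suc M)) M"
    by (subst sum_telescope) simp
  also have "\<dots> = 0"
    using bound[of "Suc M"] by (simp add: M_def coeff_eq_0)
  finally have "(\<Sum>l\<le>M. coeff g l * h l) = r 0"
    by (simp add: sum_subtractf)
  moreover have "degree g \<le> M" by (simp add: M_def)
  ultimately show ?thesis
    by (simp add: seq_functional_upto)
qed

text \<open>Each shift of \<open>h\<close> satisfies the same recurrence, so telescoping with zero
  remainders kills \<open>c\<close> under every shift, hence every multiple of
  \<open>c\<close>.\<close>

lemma seq_functional_annihilator:
  fixes R :: "nat \<Rightarrow> 'a :: comm_ring_1 poly"
  assumes "\<And>k. pCons 0 (R k) - R (Suc k) = Polynomial.smult (h k) c"
    and "\<And>k. degree (R k) \<le> N"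
  shows "seq_functional h (s * c) = 0"
proof -
  have "seq_functional (\<lambda>j. h (i + j)) c = 0" for i
    using assms
    by (intro seq_functional_telescope[where U = "\<lambda>k. R (i + k)" and r = "\<lambda>_. 0" and N = N]) simp_all
  then show ?thesis
    by (simp add: seq_functional_mult) (simp add: seq_functional_def)
qed

text \<open>Divide each \<open>R k\<close> by \<open>x - \<mu>\<close>: the quotients obey the
  telescoping relation for \<open>g\<close>, with the values \<open>poly (R k) \<mu>\<close> as
  remainders.\<close>

lemma seq_functional_cofactor:
  fixes R :: "nat \<Rightarrow> 'a :: idom poly"
  assumes step: "\<And>k. pCons 0 (R k) - R (Suc k) = Polynomial.smult (h k) ([:-\<mu>, 1:] * g)"
    and bound: "\<And>k. degree (R k) \<le> N"
  shows "seq_functional h g = poly (R 0) \<mu>"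
proof -
  define U where "U k = synthetic_div (R k) \<mu>" for k
  have R: "R k = [:-\<mu>, 1:] * U k + [:poly (R k) \<mu>:]" for k
    using synthetic_div_correct'[of \<mu> "R k"] by (simp add: U_def)
  have root: "poly (R (Suc k)) \<mu> = \<mu> * poly (R k) \<mu>" for k
    using arg_cong[OF step[of k], of "\<lambda>p. poly p \<mu>"] by simp
  \<comment> \<open>The relation for the quotients is proved after multiplication by
    \<open>x - \<mu>\<close>, where \<open>step\<close> applies; the factor is then cancelled in the
    integral domain.\<close>
  have "[:-\<mu>, 1:] * (pCons 0 (U k) - U (Suc k))
      = [:-\<mu>, 1:] * (Polynomial.smult (h k) g - [:poly (R k) \<mu>:])" for k
  proof -
    have "[:-\<mu>, 1:] * (pCons 0 (U k) - U (Suc k))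
        = [:0, 1:] * ([:-\<mu>, 1:] * U k) - [:-\<mu>, 1:] * U (Suc k)"
      by (simp add: algebra_simps)
    also have "[:-\<mu>, 1:] * U k = R k - [:poly (R k) \<mu>:]"
      using R[of k] by (simp add: algebra_simps)
    also have "[:-\<mu>, 1:] * U (Suc k) = R (Suc k) - [:\<mu> * poly (R k) \<mu>:]"
      using R[of "Suc k"] root[of k] by (simp add: algebra_simps)
    also have "[:0, 1:] * (R k - [:poly (R k) \<mu>:]) - (R (Suc k) - [:\<mu> * poly (R k) \<mu>:])
        = (pCons 0 (R k) - R (Suc k)) - [:-\<mu>, 1:] * [:poly (R k) \<mu>:]"
      by (simp add: algebra_simps)
    also have "\<dots> = [:-\<mu>, 1:] * (Polynomial.smult (h k) g - [:poly (R k) \<mu>:])"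
      unfolding step by (simp only: mult_smult_right right_diff_distrib)
    finally show ?thesis .
  qed
  then have "pCons 0 (U k) - U (Suc k) = Polynomial.smult (h k) g - [:poly (R k) \<mu>:]" for k
    using mult_left_cancel[of "[:-\<mu>, 1:]"] by simp
  moreover have "degree (U k) \<le> N" for k
    using bound[of k] by (simp add: U_def degree_synthetic_div)
  ultimately show ?thesis
    by (rule seq_functional_telescope)
qed

section \<open>Hankel determinants through Newton bases\<close>

text \<open>Only column 0 survives in the last row. Deleting both leaves a matrix of the same shape,
  and the signs \<open>(-1)^n\<close> of the expansions accumulate.\<close>

lemma det_anti_triangular:
  fixes M :: "'a :: comm_ring_1 mat"
  assumes "M \<in> carrier_mat n n"
    and "\<And>i j. i < n \<Longrightarrow> j < n \<Longrightarrow> n \<le> i + j \<Longrightarrow> M $$ (i, j) = 0"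
  shows "det M = (- 1) ^ (n * (n - 1) div 2) * (\<Prod>i<n. M $$ (i, n - 1 - i))"
  using assms
proof (induction n arbitrary: M)
  case 0
  then show ?case by simp
next
  case (Suc n)
  define M' where "M' = mat_delete M n 0"
  have M': "M' \<in> carrier_mat n n"
    using Suc.prems(1) by (auto simp: M'_def mat_delete_def)
  have M'_index: "M' $$ (i, j) = M $$ (i, Suc j)" if "i < n" "j < n" for i j
    using that Suc.prems(1) by (simp add: M'_def mat_delete_def)
  have "det M = (\<Sum>j<Suc n. M $$ (n, j) * cofactor M n j)"
    by (rule laplace_expansion_row[OF Suc.prems(1)]) simp
  also have "\<dots> = M $$ (n, 0) * cofactor M n 0"
    using Suc.prems(2)[of n] by (simp add: sum.lessThan_Suc_shift del: sum.lessThan_Suc)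
  also have "\<dots> = M $$ (n, 0) * (- 1) ^ n * det M'"
    by (simp add: cofactor_def M'_def)
  also have "det M' = (- 1) ^ (n * (n - 1) div 2) * (\<Prod>i<n. M' $$ (i, n - 1 - i))"
    using M' Suc.prems(2) by (intro Suc.IH) (auto simp: M'_index)
  also have "(\<Prod>i<n. M' $$ (i, n - 1 - i)) = (\<Prod>i<n. M $$ (i, n - i))"
    by (intro prod.cong) (auto simp: M'_index Suc_diff_Suc)
  also have "M $$ (n, 0) * (- 1) ^ n * ((- 1) ^ (n * (n - 1) div 2) * (\<Prod>i<n. M $$ (i, n - i)))
      = (- 1) ^ (n + n * (n - 1) div 2) * (\<Prod>i<Suc n. M $$ (i, n - i))"
    by (simp add: power_add algebra_simps)
  also have "n + n * (n - 1) div 2 = Suc n * (Suc n - 1) div 2"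
    by (cases n) (simp_all add: algebra_simps)
  finally show ?case by simp
qed

text \<open>A list instead of a multiset of roots: the Newton bases are built from prefixes and
  suffixes of a fixed ordering.\<close>

definition linear_factors :: "'a :: comm_ring_1 list \<Rightarrow> 'a poly" where
  "linear_factors xs = (\<Prod>a\<leftarrow>xs. [:- a, 1:])"

lemma linear_factors_simps [simp]:
  "linear_factors [] = 1"
  "linear_factors (a # xs) = [:- a, 1:] * linear_factors xs"
  "linear_factors (xs @ ys) = linear_factors xs * linear_factors ys"
  by (simp_all add: linear_factors_def)

lemma linear_factors_degree [simp]:
  "degree (linear_factors (xs :: 'a :: idom list)) = length xs"
  unfolding linear_factors_def by (rule degree_linear_factors)

lemma lead_coeff_linear_factors:
  "coeff (linear_factors (xs :: 'a :: idom list)) (length xs) = 1"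
proof -
  have "lead_coeff (linear_factors xs) = 1"
    by (induction xs) (simp_all add: lead_coeff_mult del: linear_factors_degree mult_pCons_left)
  then show ?thesis by simp
qed

lemma det_unit_lower_triangular:
  assumes "M \<in> carrier_mat n n"
    and "\<And>i j. i < j \<Longrightarrow> j < n \<Longrightarrow> M $$ (i, j) = 0"
    and "\<And>i. i < n \<Longrightarrow> M $$ (i, i) = 1"
  shows "det M = 1"
proof -
  have "det M = prod_list (diag_mat M)"
    using assms by (intro det_lower_triangular)
  also have "diag_mat M = replicate n 1"
    using assms by (intro nth_equalityI) (auto simp: diag_mat_def)
  finally show ?thesis by simp
qed

definition hankel_mat :: "nat \<Rightarrow> (nat \<Rightarrow> 'a) \<Rightarrow> 'a mat" where
  "hankel_mat n h = mat n n (\<lambda>(i, j). h (i + j))"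

definition coeff_mat :: "nat \<Rightarrow> (nat \<Rightarrow> 'a :: zero poly) \<Rightarrow> 'a mat" where
  "coeff_mat n p = mat n n (\<lambda>(k, i). coeff (p k) i)"

text \<open>Degrees below \<open>n\<close> ensure that truncating to \<open>n\<close> coefficients
  loses nothing in the bilinear form \<open>\<phi>(p q)\<close>.\<close>

lemma hankel_gram:
  fixes p q :: "nat \<Rightarrow> 'a :: comm_ring_1 poly"
  assumes "\<And>k. k < n \<Longrightarrow> degree (p k) < n" "\<And>k. k < n \<Longrightarrow> degree (q k) < n"
  shows "coeff_mat n p * hankel_mat n h * (coeff_mat n q)\<^sup>T
    = mat n n (\<lambda>(k, m). seq_functional h (p k * q m))"
    (is "?L = ?R")
proof (rule eq_matI)
  fix k m
  assume "k < dim_row ?R" "m < dim_col ?R"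
  then have km: "k < n" "m < n" by simp_all
  then obtain N where n: "n = Suc N" by (cases n) auto
  have deg: "degree (p k) \<le> N" "degree (q m) \<le> N"
    using assms[of k] assms(2)[of m] km n by auto
  have "seq_functional h (p k * q m)
      = (\<Sum>i<n. coeff (p k) i * (\<Sum>j<n. coeff (q m) j * h (i + j)))"
    using deg by (simp add: seq_functional_mult seq_functional_upto[where N = N] n lessThan_Suc_atMost)
  also have "\<dots> = (\<Sum>j<n. (\<Sum>i<n. coeff (p k) i * h (i + j)) * coeff (q m) j)"
    unfolding sum_distrib_left sum_distrib_right
    by (subst sum.swap) (simp add: algebra_simps)
  also have "\<dots> = ?L $$ (k, m)"
    using km by (simp add: coeff_mat_def hankel_mat_def scalar_prod_def atLeast0LessThan)
  finally show "?L $$ (k, m) = ?R $$ (k, m)"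
    using km by simp
qed (simp_all add: coeff_mat_def)

lemma det_hankel:
  fixes h :: "nat \<Rightarrow> 'a :: idom"
  assumes annihilator: "\<And>s. seq_functional h (s * linear_factors xs) = 0"
  shows "det (hankel_mat (length xs) h) = (- 1) ^ (length xs * (length xs - 1) div 2) *
    (\<Prod>k<length xs. seq_functional h (linear_factors (take k xs @ drop (Suc k) xs)))"
proof -
  define n where "n = length xs"
  \<comment> \<open>\<open>p k\<close> takes the first \<open>k\<close> factors and
    \<open>q m\<close> the last \<open>m\<close>. Together they cover the list if
    \<open>n \<le> k + m\<close>, and miss exactly the factor at \<open>k\<close> if
    \<open>k + m = n - 1\<close>.\<close>
  define p where "p k = linear_factors (take k xs)" for k
  define q where "q m = linear_factors (drop (n - m) xs)" for m
  have deg_p: "degree (p k) = k" and lead_p: "coeff (p k) k = 1" if "k < n" for k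
    using that lead_coeff_linear_factors[of "take k xs"] by (simp_all add: p_def n_def min_def)
  have deg_q: "degree (q k) = k" and lead_q: "coeff (q k) k = 1" if "k < n" for k
    using that lead_coeff_linear_factors[of "drop (n - k) xs"] by (simp_all add: q_def n_def)
  have det_p: "det (coeff_mat n p) = 1" and det_q: "det (coeff_mat n q) = 1"
    by (auto intro!: det_unit_lower_triangular[of _ n]
        simp: coeff_mat_def deg_p deg_q lead_p lead_q coeff_eq_0)
  have carrier: "coeff_mat n p \<in> carrier_mat n n" "coeff_mat n q \<in> carrier_mat n n"
      "hankel_mat n h \<in> carrier_mat n n"
    by (simp_all add: coeff_mat_def hankel_mat_def)
  define G where "G = mat n n (\<lambda>(k, m). seq_functional h (p k * q m))"
  have "G = coeff_mat n p * hankel_mat n h * (coeff_mat n q)\<^sup>T"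
    unfolding G_def by (rule hankel_gram[symmetric]) (simp_all add: deg_p deg_q)
  also have "det \<dots> = det (coeff_mat n p) * det (hankel_mat n h) * det (coeff_mat n q)"
    using carrier by (simp add: det_mult[of _ n] det_transpose)
  finally have "det (hankel_mat n h) = det G"
    by (simp add: det_p det_q)
  also have "det G = (- 1) ^ (n * (n - 1) div 2) * (\<Prod>i<n. G $$ (i, n - 1 - i))"
  proof (rule det_anti_triangular)
    fix k m
    assume km: "k < n" "m < n" "n \<le> k + m"
    \<comment> \<open>The prefix is cut where the suffix of \<open>q m\<close> starts: its first
      piece completes \<open>q m\<close> to the full product, its second is the cofactor
      \<open>s\<close>.\<close>
    have "take k xs = take (n - m) xs @ drop (n - m) (take k xs)"
      using km append_take_drop_id[of "n - m" "take k xs"] by (simp add: min_absorb1)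
    then have "p k * q m = linear_factors (drop (n - m) (take k xs)) *
        (linear_factors (take (n - m) xs) * linear_factors (drop (n - m) xs))"
      unfolding p_def q_def by (metis linear_factors_simps(3) mult.assoc mult.commute)
    also have "linear_factors (take (n - m) xs) * linear_factors (drop (n - m) xs) = linear_factors xs"
      by (metis linear_factors_simps(3) append_take_drop_id)
    finally show "G $$ (k, m) = 0"
      using km annihilator by (simp add: G_def)
  qed (simp add: G_def)
  also have "(\<Prod>i<n. G $$ (i, n - 1 - i))
      = (\<Prod>k<n. seq_functional h (linear_factors (take k xs @ drop (Suc k) xs)))"
    by (intro prod.cong) (auto simp: G_def p_def q_def)
  finally show ?thesis by (simp add: n_def)
qed

subsection \<open>Bordered matrices and their powers\<close>

text \<open>Row, column and corner are kept as matrices, so that all block products are matrix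
  products.\<close>

definition last_col :: "nat \<Rightarrow> 'a mat \<Rightarrow> 'a mat" where
  "last_col n M = mat n 1 (\<lambda>(i, j). M $$ (i, n))"

definition last_row :: "nat \<Rightarrow> 'a mat \<Rightarrow> 'a mat" where
  "last_row n M = mat 1 n (\<lambda>(i, j). M $$ (n, j))"

definition corner :: "nat \<Rightarrow> 'a mat \<Rightarrow> 'a mat" where
  "corner n M = mat 1 1 (\<lambda>_. M $$ (n, n))"

lemma block_dim [simp]:
  "dim_row (upper_left n T) = n" "dim_col (upper_left n T) = n"
  "dim_row (last_col n M) = n" "dim_col (last_col n M) = 1"
  "dim_row (last_row n M) = 1" "dim_col (last_row n M) = n"
  "dim_row (corner n M) = 1" "dim_col (corner n M) = 1"
  by (simp_all add: upper_left_def last_col_def last_row_def corner_def)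

lemma mult_mat_assoc_dim:
  fixes A B C :: "'a :: semiring_0 mat"
  assumes "dim_col A = dim_row B" "dim_col B = dim_row C"
  shows "A * B * C = A * (B * C)"
  using assms by (intro assoc_mult_mat) auto

lemma mult_mat_distrib_dim:
  fixes A B C :: "'a :: semiring_0 mat"
  shows "dim_row A = dim_row B \<Longrightarrow> dim_col A = dim_row C \<Longrightarrow> dim_col B = dim_row C
    \<Longrightarrow> (A + B) * C = A * C + B * C"
    and "dim_col A = dim_row B \<Longrightarrow> dim_row C = dim_row B \<Longrightarrow> dim_col C = dim_col B
    \<Longrightarrow> A * (B + C) = A * B + A * C"
  by (rule add_mult_distrib_mat; auto) (rule mult_add_distrib_mat; auto)

lemma four_block_mat_mult_dim:
  assumes "dim_row B1 = dim_row A1" "dim_col C1 = dim_col A1" "dim_row D1 = dim_row C1"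
    "dim_col D1 = dim_col B1" "dim_row A2 = dim_col A1" "dim_row B2 = dim_col A1"
    "dim_row C2 = dim_col B1" "dim_row D2 = dim_col B1" "dim_col C2 = dim_col A2"
    "dim_col D2 = dim_col B2"
  shows "four_block_mat A1 B1 C1 D1 * four_block_mat A2 B2 C2 D2
    = four_block_mat (A1 * A2 + B1 * C2) (A1 * B2 + B1 * D2) (C1 * A2 + D1 * C2) (C1 * B2 + D1 * D2)"
  using assms by (intro mult_four_block_mat) auto

lemma four_block_mat_minus_dim:
  assumes "dim_row B1 = dim_row A1" "dim_col C1 = dim_col A1" "dim_row D1 = dim_row C1"
    "dim_col D1 = dim_col B1" "dim_row A2 = dim_row A1" "dim_col A2 = dim_col A1"
    "dim_row B2 = dim_row B1" "dim_col B2 = dim_col B1" "dim_row C2 = dim_row C1"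
    "dim_col C2 = dim_col C1" "dim_row D2 = dim_row D1" "dim_col D2 = dim_col D1"
  shows "four_block_mat A1 B1 C1 D1 - four_block_mat A2 B2 C2 D2
    = four_block_mat (A1 - A2) (B1 - B2) (C1 - C2) (D1 - D2)"
  using assms by (intro eq_matI) auto

lemma bordered_block_decomp:
  assumes "M \<in> carrier_mat (n + 1) (n + 1)"
  shows "M = four_block_mat (upper_left n M) (last_col n M) (last_row n M) (corner n M)"
  using assms
  by (intro eq_matI) (auto simp: upper_left_def last_col_def last_row_def corner_def less_Suc_eq)

lemma block_four_block_mat:
  assumes "A \<in> carrier_mat n n" "B \<in> carrier_mat n 1" "C \<in> carrier_mat 1 n" "D \<in> carrier_mat 1 1"
  shows "upper_left n (four_block_mat A B C D) = A" "last_col n (four_block_mat A B C D) = B"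
    "last_row n (four_block_mat A B C D) = C" "corner n (four_block_mat A B C D) = D"
  using assms
  by (auto intro!: eq_matI simp: upper_left_def last_col_def last_row_def corner_def)

lemma block_mult:
  assumes "M \<in> carrier_mat (n + 1) (n + 1)" "N \<in> carrier_mat (n + 1) (n + 1)"
  shows "last_col n (M * N) = upper_left n M * last_col n N + last_col n M * corner n N"
    "last_row n (M * N) = last_row n M * upper_left n N + corner n M * last_row n N"
proof -
  have MN: "M * N = four_block_mat
      (upper_left n M * upper_left n N + last_col n M * last_row n N)
      (upper_left n M * last_col n N + last_col n M * corner n N)
      (last_row n M * upper_left n N + corner n M * last_row n N)
      (last_row n M * last_col n N + corner n M * corner n N)"
    by (subst (1) bordered_block_decomp[OF assms(1)], subst (1) bordered_block_decomp[OF assms(2)])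
      (rule four_block_mat_mult_dim; simp)
  have carrier: "upper_left n M * upper_left n N + last_col n M * last_row n N \<in> carrier_mat n n"
    "upper_left n M * last_col n N + last_col n M * corner n N \<in> carrier_mat n 1"
    "last_row n M * upper_left n N + corner n M * last_row n N \<in> carrier_mat 1 n"
    "last_row n M * last_col n N + corner n M * corner n N \<in> carrier_mat 1 1"
    by (rule carrier_matI; simp)+
  show "last_col n (M * N) = upper_left n M * last_col n N + last_col n M * corner n N"
    and "last_row n (M * N) = last_row n M * upper_left n N + corner n M * last_row n N"
    unfolding MN using block_four_block_mat[OF carrier] by simp_all
qed

lemma mat_trace_mult_comm:
  fixes M N :: "'a :: comm_semiring_0 mat"
  assumes "M \<in> carrier_mat nr nc" "N \<in> carrier_mat nc nr"
  shows "mat_trace (M * N) = mat_trace (N * M)"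
proof -
  have "mat_trace (M * N) = (\<Sum>i<nr. \<Sum>j<nc. M $$ (i, j) * N $$ (j, i))"
    using assms by (auto simp: mat_trace_def scalar_prod_def atLeast0LessThan intro!: sum.cong)
  also have "\<dots> = (\<Sum>j<nc. \<Sum>i<nr. N $$ (j, i) * M $$ (i, j))"
    by (subst sum.swap) (simp add: mult.commute)
  also have "\<dots> = mat_trace (N * M)"
    using assms by (auto simp: mat_trace_def scalar_prod_def atLeast0LessThan intro!: sum.cong)
  finally show ?thesis .
qed

lemma mat_trace_four_block:
  assumes "dim_row A = dim_col A" "dim_row D = 1" "dim_col D = 1"
  shows "mat_trace (four_block_mat A B C D) = mat_trace A + D $$ (0, 0)"
  using assms by (auto simp: mat_trace_def)

section \<open>Block form of the entries of \<open>D_mat\<close>\<close>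

lemma H_one_block: "H_one n = four_block_mat (1\<^sub>m n) (0\<^sub>m n 1) (0\<^sub>m 1 n) (0\<^sub>m 1 1)"
  by (intro eq_matI) (auto simp: H_one_def)

text \<open>The corner of the power of \<open>H_part\<close> is \<open>0^k\<close>, which is 1 for
  \<open>k = 0\<close>; multiplication by \<open>H_one\<close> erases it.\<close>

lemma H_pow_block:
  "H_pow n \<tau> k = four_block_mat (upper_left n \<tau> ^\<^sub>m k) (0\<^sub>m n 1) (0\<^sub>m 1 n) (0\<^sub>m 1 1)"
proof -
  have "H_part n \<tau> = four_block_mat (upper_left n \<tau>) (0\<^sub>m n 1) (0\<^sub>m 1 n) (0\<^sub>m 1 1)"
    by (intro eq_matI) (auto simp: H_part_def upper_left_def)
  then have "H_part n \<tau> ^\<^sub>m k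
      = four_block_mat (upper_left n \<tau> ^\<^sub>m k) (0\<^sub>m n 1) (0\<^sub>m 1 n) (0\<^sub>m 1 1 ^\<^sub>m k)"
    by (simp only:) (rule pow_four_block_mat; rule carrier_matI; simp)
  then show ?thesis
    unfolding H_pow_def H_one_block
    by (simp add: four_block_mat_mult_dim) (intro impI cong_four_block_mat; auto intro!: eq_matI)
qed

text \<open>Bracketing with \<open>H_one\<close> kills the diagonal blocks, keeps the upper right
  block and negates the lower left one. The trace against \<open>\<tau>\<close> then pairs these
  with its last row and column.\<close>

lemma D_entry_eq:
  assumes \<tau>: "\<tau> \<in> carrier_mat (n + 1) (n + 1)"
  shows "D_entry n \<tau> i (Suc k) =
    - ((last_row n \<tau> * upper_left n \<tau> ^\<^sub>m k * last_col n (\<tau> ^\<^sub>m i)) $$ (0, 0)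
     + (last_row n (\<tau> ^\<^sub>m i) * upper_left n \<tau> ^\<^sub>m k * last_col n \<tau>) $$ (0, 0))"
proof -
  define A B C d where "A = upper_left n \<tau>" and "B = last_col n \<tau>" and "C = last_row n \<tau>"
    and "d = corner n \<tau>"
  define T u v w where "T = upper_left n (\<tau> ^\<^sub>m i)" and "u = last_col n (\<tau> ^\<^sub>m i)"
    and "v = last_row n (\<tau> ^\<^sub>m i)" and "w = corner n (\<tau> ^\<^sub>m i)"
  define Q where "Q = A ^\<^sub>m k"
  have dims [simp]: "dim_row A = n" "dim_col A = n" "dim_row B = n" "dim_col B = 1"
      "dim_row C = 1" "dim_col C = n" "dim_row d = 1" "dim_col d = 1"
      "dim_row T = n" "dim_col T = n" "dim_row u = n" "dim_col u = 1"
      "dim_row v = 1" "dim_col v = n" "dim_row w = 1" "dim_col w = 1"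
      "dim_row Q = n" "dim_col Q = n"
    by (simp_all add: A_def B_def C_def d_def T_def u_def v_def w_def Q_def)
  have \<tau>_block: "\<tau> = four_block_mat A B C d"
    unfolding A_def B_def C_def d_def by (rule bordered_block_decomp[OF \<tau>])
  have pow_block: "\<tau> ^\<^sub>m i = four_block_mat T u v w"
    unfolding T_def u_def v_def w_def
    by (rule bordered_block_decomp) (rule pow_carrier_mat[OF \<tau>])
  define X where "X = T * Q - Q * T"
  have X [simp]: "dim_row X = n" "dim_col X = n" by (simp_all add: X_def)
  have "mat_bracket (\<tau> ^\<^sub>m i) (H_pow n \<tau> k) = four_block_mat X (- (Q * u)) (v * Q) (0\<^sub>m 1 1)"
    unfolding mat_bracket_def pow_block H_pow_block A_def[symmetric] Q_def[symmetric] X_def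
    by (simp add: four_block_mat_mult_dim four_block_mat_minus_dim) (intro cong_four_block_mat; auto intro!: eq_matI)
  then have "mat_bracket (H_one n) (mat_bracket (\<tau> ^\<^sub>m i) (H_pow n \<tau> k))
      = four_block_mat (0\<^sub>m n n) (- (Q * u)) (- (v * Q)) (0\<^sub>m 1 1)"
    unfolding H_one_block
    by (simp only:, simp add: mat_bracket_def four_block_mat_mult_dim four_block_mat_minus_dim) (intro cong_four_block_mat; auto intro!: eq_matI)
  then have "D_entry n \<tau> i (Suc k)
      = mat_trace (four_block_mat (0\<^sub>m n n) (- (Q * u)) (- (v * Q)) (0\<^sub>m 1 1) * four_block_mat A B C d)"
    by (simp add: D_entry_def trace_pairing_def flip: \<tau>_block)
  also have "\<dots> = mat_trace (0\<^sub>m n n + - (Q * u * C)) - (v * Q * B) $$ (0, 0)"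
    by (simp add: four_block_mat_mult_dim mat_trace_four_block)
  also have "mat_trace (0\<^sub>m n n + - (Q * u * C)) = - mat_trace (Q * u * C)"
    by (simp add: mat_trace_def sum_negf)
  also have "mat_trace (Q * u * C) = mat_trace (C * (Q * u))"
    by (rule mat_trace_mult_comm[of _ n 1]) (rule carrier_matI; simp)+
  also have "C * (Q * u) = C * Q * u"
    by (simp add: mult_mat_assoc_dim)
  also have "mat_trace (C * Q * u) = (C * Q * u) $$ (0, 0)"
    by (simp add: mat_trace_def)
  finally show ?thesis
    by (simp add: A_def B_def C_def u_def v_def Q_def)
qed

section \<open>Reduction to a Hankel determinant of moments\<close>

definition bordered_moment :: "nat \<Rightarrow> complex mat \<Rightarrow> nat \<Rightarrow> complex" where
  "bordered_moment n \<tau> k = (last_row n \<tau> * upper_left n \<tau> ^\<^sub>m k * last_col n \<tau>) $$ (0, 0)"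

lemma pow_mat_Suc_left:
  assumes "M \<in> carrier_mat n n"
  shows "M ^\<^sub>m Suc k = M * M ^\<^sub>m k"
proof (induction k)
  case 0
  then show ?case using assms by simp
next
  case (Suc k)
  have "M ^\<^sub>m Suc (Suc k) = (M * M ^\<^sub>m k) * M"
    using Suc by simp
  also have "\<dots> = M * (M ^\<^sub>m k * M)"
    using assms by (intro assoc_mult_mat) (auto intro: pow_carrier_mat)
  finally show ?case by simp
qed

text \<open>The last row of \<open>\<tau>^i * \<tau>\<close> is \<open>v A + w C\<close>: the first
  term raises \<open>k\<close> by one, the second contributes a moment. Hence the induction is for
  all \<open>k\<close>.\<close>

lemma last_row_pow_moment:
  assumes \<tau>: "\<tau> \<in> carrier_mat (n + 1) (n + 1)"
  shows "(last_row n (\<tau> ^\<^sub>m i) * upper_left n \<tau> ^\<^sub>m k * last_col n \<tau>) $$ (0, 0)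
    = (\<Sum>m<i. (\<tau> ^\<^sub>m (i - Suc m)) $$ (n, n) * bordered_moment n \<tau> (m + k))"
proof (induction i arbitrary: k)
  case 0
  have "last_row n (1\<^sub>m (n + 1) :: complex mat) = 0\<^sub>m 1 n"
    by (intro eq_matI) (auto simp: last_row_def)
  then show ?case
    using \<tau> by simp
next
  case (Suc i)
  define A B C where "A = upper_left n \<tau>" and "B = last_col n \<tau>" and "C = last_row n \<tau>"
  define v w where "v = last_row n (\<tau> ^\<^sub>m i)" and "w = corner n (\<tau> ^\<^sub>m i)"
  have dims [simp]: "dim_row A = n" "dim_col A = n" "dim_row B = n" "dim_col B = 1"
      "dim_row C = 1" "dim_col C = n" "dim_row v = 1" "dim_col v = n" "dim_row w = 1" "dim_col w = 1"
    by (simp_all add: A_def B_def C_def v_def w_def)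
  have "last_row n (\<tau> ^\<^sub>m Suc i) = v * A + w * C"
    using \<tau> by (simp add: block_mult(2) pow_carrier_mat A_def C_def v_def w_def)
  then have "last_row n (\<tau> ^\<^sub>m Suc i) * A ^\<^sub>m k * B = v * (A * A ^\<^sub>m k) * B + w * (C * A ^\<^sub>m k * B)"
    by (simp add: mult_mat_distrib_dim mult_mat_assoc_dim)
  also have "A * A ^\<^sub>m k = A ^\<^sub>m Suc k"
    by (rule pow_mat_Suc_left[symmetric, of _ n]) (rule carrier_matI; simp)
  finally have "(last_row n (\<tau> ^\<^sub>m Suc i) * A ^\<^sub>m k * B) $$ (0, 0)
      = (v * A ^\<^sub>m Suc k * B) $$ (0, 0) + w $$ (0, 0) * bordered_moment n \<tau> k"
    by (simp add: scalar_prod_def bordered_moment_def A_def B_def C_def)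
  also have "(v * A ^\<^sub>m Suc k * B) $$ (0, 0)
      = (\<Sum>m<i. (\<tau> ^\<^sub>m (i - Suc m)) $$ (n, n) * bordered_moment n \<tau> (Suc m + k))"
    using Suc[of "Suc k"] by (simp add: A_def B_def v_def)
  finally show ?case
    by (simp add: sum.lessThan_Suc_shift A_def B_def w_def corner_def del: sum.lessThan_Suc)
qed

text \<open>The mirror image, splitting off \<open>\<tau>\<close> on the left. The sum agrees with
  the one for the last row, which produces the factor 2 in \<open>D_mat\<close>.\<close>

lemma last_col_pow_moment:
  assumes \<tau>: "\<tau> \<in> carrier_mat (n + 1) (n + 1)"
  shows "(last_row n \<tau> * upper_left n \<tau> ^\<^sub>m k * last_col n (\<tau> ^\<^sub>m i)) $$ (0, 0)
    = (\<Sum>m<i. (\<tau> ^\<^sub>m (i - Suc m)) $$ (n, n) * bordered_moment n \<tau> (m + k))"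
proof (induction i arbitrary: k)
  case 0
  have "last_col n (1\<^sub>m (n + 1) :: complex mat) = 0\<^sub>m n 1"
    by (intro eq_matI) (auto simp: last_col_def)
  then show ?case
    using \<tau> by simp
next
  case (Suc i)
  define A B C where "A = upper_left n \<tau>" and "B = last_col n \<tau>" and "C = last_row n \<tau>"
  define u w where "u = last_col n (\<tau> ^\<^sub>m i)" and "w = corner n (\<tau> ^\<^sub>m i)"
  have dims [simp]: "dim_row A = n" "dim_col A = n" "dim_row B = n" "dim_col B = 1"
      "dim_row C = 1" "dim_col C = n" "dim_row u = n" "dim_col u = 1" "dim_row w = 1" "dim_col w = 1"
    by (simp_all add: A_def B_def C_def u_def w_def)
  have "last_col n (\<tau> ^\<^sub>m Suc i) = A * u + B * w"
    unfolding pow_mat_Suc_left[OF \<tau>] 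
    using \<tau> by (simp add: block_mult(1) pow_carrier_mat A_def B_def u_def w_def)
  then have "C * A ^\<^sub>m k * last_col n (\<tau> ^\<^sub>m Suc i) = C * (A ^\<^sub>m k * A) * u + C * A ^\<^sub>m k * B * w"
    by (simp add: mult_mat_distrib_dim mult_mat_assoc_dim)
  then have "(C * A ^\<^sub>m k * last_col n (\<tau> ^\<^sub>m Suc i)) $$ (0, 0)
      = (C * A ^\<^sub>m Suc k * u) $$ (0, 0) + w $$ (0, 0) * bordered_moment n \<tau> k"
    by (simp add: scalar_prod_def bordered_moment_def A_def B_def C_def)
  also have "(C * A ^\<^sub>m Suc k * u) $$ (0, 0)
      = (\<Sum>m<i. (\<tau> ^\<^sub>m (i - Suc m)) $$ (n, n) * bordered_moment n \<tau> (Suc m + k))"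
    using Suc[of "Suc k"] by (simp add: A_def C_def u_def)
  finally show ?case
    by (simp add: sum.lessThan_Suc_shift A_def C_def w_def corner_def del: sum.lessThan_Suc)
qed

lemma Delta_eq_det_hankel:
  assumes \<tau>: "\<tau> \<in> carrier_mat (n + 1) (n + 1)"
  shows "Delta n \<tau> = (- 2) ^ n * det (hankel_mat n (bordered_moment n \<tau>))"
proof -
  \<comment> \<open>The exponent is \<open>(i + 1) - (m + 1)\<close>, by the index shift in
    \<open>D_mat\<close>; the diagonal is 1 since \<open>\<tau>^0\<close> is the identity.\<close>
  define L where "L = mat n n (\<lambda>(i, m). if m \<le> i then (\<tau> ^\<^sub>m (i - m)) $$ (n, n) else 0)"
  define H where "H = hankel_mat n (bordered_moment n \<tau>)"
  have carrier: "L \<in> carrier_mat n n" "H \<in> carrier_mat n n"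
    by (simp_all add: L_def H_def hankel_mat_def)
  have "D_mat n \<tau> = (- 2) \<cdot>\<^sub>m (L * H)"
  proof (intro eq_matI)
    fix i j
    assume "i < dim_row ((- 2) \<cdot>\<^sub>m (L * H))" "j < dim_col ((- 2) \<cdot>\<^sub>m (L * H))"
    then have ij: "i < n" "j < n" using carrier by auto
    have "(L * H) $$ (i, j) = (\<Sum>m<n. L $$ (i, m) * H $$ (m, j))"
      using ij carrier by (simp add: scalar_prod_def atLeast0LessThan)
    also have "\<dots> = (\<Sum>m<Suc i. L $$ (i, m) * H $$ (m, j))"
      using ij by (intro sum.mono_neutral_right) (auto simp: L_def)
    also have "\<dots> = (\<Sum>m<Suc i. (\<tau> ^\<^sub>m (Suc i - Suc m)) $$ (n, n) * bordered_moment n \<tau> (m + j))"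
      using ij by (intro sum.cong) (auto simp: L_def H_def hankel_mat_def)
    finally have LH: "(L * H) $$ (i, j) = \<dots>" .
    have "D_mat n \<tau> $$ (i, j) = D_entry n \<tau> (Suc i) (Suc j)"
      using ij by (simp add: D_mat_def)
    also have "\<dots> = - 2 * (L * H) $$ (i, j)"
      unfolding D_entry_eq[OF \<tau>] last_row_pow_moment[OF \<tau>] last_col_pow_moment[OF \<tau>] LH by simp
    finally show "D_mat n \<tau> $$ (i, j) = ((- 2) \<cdot>\<^sub>m (L * H)) $$ (i, j)"
      using ij carrier by simp
  qed (use carrier in \<open>auto simp: D_mat_def\<close>)
  then have "Delta n \<tau> = (- 2) ^ n * (det L * det H)"
    using carrier by (simp add: Delta_def det_mult[of _ n])
  moreover have "det L = 1"
    using \<tau> by (intro det_unit_lower_triangular[of _ n]) (auto simp: L_def)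
  ultimately show ?thesis by (simp add: H_def)
qed

subsection \<open>The characteristic polynomial of a bordered matrix\<close>

abbreviation const_mat :: "'a :: zero mat \<Rightarrow> 'a poly mat" where
  "const_mat \<equiv> map_mat (\<lambda>a. [:a:])"

lemma const_mat_mult:
  fixes M N :: "'a :: comm_ring_1 mat"
  assumes "dim_col M = dim_row N"
  shows "const_mat (M * N) = const_mat M * const_mat N"
  using assms by (intro map_poly_mult(1)) auto

lemma char_poly_matrix_mult_left:
  fixes A :: "'a :: comm_ring_1 mat"
  assumes "A \<in> carrier_mat n n" "M \<in> carrier_mat m n"
  shows "const_mat M * char_poly_matrix A = [:0, 1:] \<cdot>\<^sub>m const_mat M - const_mat (M * A)"
proof -
  have A: "char_poly_matrix A = [:0, 1:] \<cdot>\<^sub>m 1\<^sub>m n - const_mat A"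
    using assms by (intro eq_matI) (auto simp: char_poly_matrix_def)
  show ?thesis
    unfolding A using assms
    by (subst mult_minus_distrib_mat[of _ m n _ n]) (auto simp: const_mat_mult mult_smult_distrib[of _ m n _ n])
qed

text \<open>This is \<open>C A^k (x - A)^(-1) B\<close> times the characteristic polynomial of
  \<open>A\<close>; the adjugate keeps it polynomial.\<close>

definition resolvent_moment :: "'a :: comm_ring_1 mat \<Rightarrow> 'a mat \<Rightarrow> 'a mat \<Rightarrow> nat \<Rightarrow> 'a poly" where
  "resolvent_moment A B C k =
    (const_mat (C * A ^\<^sub>m k) * adj_mat (char_poly_matrix A) * const_mat B) $$ (0, 0)"

text \<open>Evaluate \<open>C A^k (x - A) adj(x - A) B\<close> in two ways: expand
  \<open>x - A\<close> against \<open>C A^k\<close>, or contract it with its adjugate.\<close>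

lemma resolvent_moment_step:
  fixes A :: "'a :: comm_ring_1 mat"
  assumes A: "A \<in> carrier_mat n n" and B: "B \<in> carrier_mat n 1" and C: "C \<in> carrier_mat 1 n"
  shows "pCons 0 (resolvent_moment A B C k) - resolvent_moment A B C (Suc k)
    = Polynomial.smult ((C * A ^\<^sub>m k * B) $$ (0, 0)) (char_poly A)"
proof -
  define M where "M = C * A ^\<^sub>m k"
  define G where "G = adj_mat (char_poly_matrix A)"
  have M: "M \<in> carrier_mat 1 n" using A C by (auto simp: M_def)
  have G: "G \<in> carrier_mat n n" "char_poly_matrix A * G = char_poly A \<cdot>\<^sub>m 1\<^sub>m n"
    using adj_mat[of "char_poly_matrix A" n] A by (simp_all add: G_def char_poly_def)
  have Suc_pow: "C * A ^\<^sub>m Suc k = M * A"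
    using A C by (simp add: M_def mult_mat_assoc_dim)
  have dims: "dim_row M = 1" "dim_col M = n" "dim_row G = n" "dim_col G = n" "dim_row B = n" "dim_col B = 1"
    "dim_row A = n" "dim_col A = n"
    using A B M G by auto
  have "([:0, 1:] \<cdot>\<^sub>m const_mat M - const_mat (M * A)) * G * const_mat B
      = const_mat M * char_poly_matrix A * G * const_mat B"
    by (simp only: char_poly_matrix_mult_left[OF A M])
  also have "\<dots> = const_mat M * (char_poly_matrix A * G) * const_mat B"
    using dims by (simp add: mult_mat_assoc_dim char_poly_matrix_def)
  also have "\<dots> = char_poly A \<cdot>\<^sub>m const_mat (M * B)"
    unfolding G(2) using M B dims
    by (simp add: mult_smult_distrib[of _ 1 n _ n] mult_smult_assoc_mat[of _ 1 n _ 1] const_mat_mult)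
  finally have "([:0, 1:] \<cdot>\<^sub>m const_mat M - const_mat (M * A)) * G * const_mat B
      = char_poly A \<cdot>\<^sub>m const_mat (M * B)" .
  moreover have "([:0, 1:] \<cdot>\<^sub>m const_mat M - const_mat (M * A)) * G * const_mat B
      = [:0, 1:] \<cdot>\<^sub>m (const_mat M * G * const_mat B) - const_mat (M * A) * G * const_mat B"
  proof -
    have "const_mat M \<in> carrier_mat 1 n" "const_mat (M * A) \<in> carrier_mat 1 n"
        "const_mat M * G \<in> carrier_mat 1 n" "const_mat (M * A) * G \<in> carrier_mat 1 n"
        "const_mat B \<in> carrier_mat n 1"
      using dims by (auto intro!: carrier_matI)
    then show ?thesis
      using G(1) by (simp add: minus_mult_distrib_mat[of _ 1 n _ _ n] minus_mult_distrib_mat[of _ 1 n _ _ 1]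
          mult_smult_assoc_mat[of _ 1 n _ n] mult_smult_assoc_mat[of _ 1 n _ 1] del: assoc_mult_mat)
  qed
  ultimately have "([:0, 1:] \<cdot>\<^sub>m (const_mat M * G * const_mat B) - const_mat (M * A) * G * const_mat B) $$ (0, 0)
      = (char_poly A \<cdot>\<^sub>m const_mat (M * B)) $$ (0, 0)"
    by simp
  then show ?thesis
    unfolding resolvent_moment_def Suc_pow M_def[symmetric] G_def[symmetric]
    using dims by (simp add: mult.commute)
qed

text \<open>Only the constant row \<open>C A^k\<close> depends on \<open>k\<close>, so the degrees
  of the adjugate's entries bound all cases at once.\<close>

lemma resolvent_moment_degree_bounded:
  fixes A :: "'a :: comm_ring_1 mat"
  assumes "A \<in> carrier_mat n n" "B \<in> carrier_mat n 1" "C \<in> carrier_mat 1 n"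
  shows "\<exists>N. \<forall>k. degree (resolvent_moment A B C k) \<le> N"
proof -
  define G where "G = adj_mat (char_poly_matrix A)"
  have G: "G \<in> carrier_mat n n"
    using adj_mat[of "char_poly_matrix A" n] assms by (simp add: G_def)
  \<comment> \<open>Inserting 0 keeps the set nonempty when \<open>n = 0\<close>.\<close>
  define N where "N = Max (insert 0 ((\<lambda>(i, j). degree (G $$ (i, j))) ` ({..<n} \<times> {..<n})))"
  have N: "degree (G $$ (i, j)) \<le> N" if "i < n" "j < n" for i j
    unfolding N_def using that by (intro Max_ge) auto
  have "degree (resolvent_moment A B C k) \<le> N" for k
  proof -
    define M where "M = C * A ^\<^sub>m k"
    have M: "M \<in> carrier_mat 1 n" using assms by (auto simp: M_def)
    have "resolvent_moment A B C k
        = (\<Sum>i<n. Polynomial.smult (M $$ (0, i)) (\<Sum>j<n. Polynomial.smult (B $$ (j, 0)) (G $$ (i, j))))"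
      unfolding resolvent_moment_def M_def[symmetric] G_def[symmetric]
      using assms M G by (simp add: scalar_prod_def atLeast0LessThan)
    also have "degree \<dots> \<le> N"
      using N by (auto intro!: degree_sum_le order.trans[OF degree_smult_le])
    finally show ?thesis .
  qed
  then show ?thesis by blast
qed

text \<open>A Schur complement without inverses: right multiplication by a block matrix of
  determinant \<open>char_poly A\<close> clears the upper right block, and that nonzero factor is
  cancelled at the end.\<close>

lemma char_poly_bordered:
  fixes A :: "'a :: idom mat"
  assumes A: "A \<in> carrier_mat n n" and B: "B \<in> carrier_mat n 1" and C: "C \<in> carrier_mat 1 n"
    and D: "D \<in> carrier_mat 1 1"
  shows "char_poly (four_block_mat A B C D)
    = [:- D $$ (0, 0), 1:] * char_poly A - resolvent_moment A B C 0"
proof -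
  define X where "X = char_poly_matrix A"
  define c where "c = char_poly A"
  define G where "G = adj_mat X"
  define b where "b = const_mat B"
  define r where "r = const_mat C"
  define d where "d = mat 1 1 (\<lambda>_. [:- D $$ (0, 0), 1:])"
  define V where "V = G * b"
  have G: "G \<in> carrier_mat n n" "X * G = c \<cdot>\<^sub>m 1\<^sub>m n"
    using adj_mat[of X n] A by (simp_all add: G_def X_def c_def char_poly_def)
  have carrier: "X \<in> carrier_mat n n" "b \<in> carrier_mat n 1" "r \<in> carrier_mat 1 n"
      "d \<in> carrier_mat 1 1" "V \<in> carrier_mat n 1"
    using A B C G(1) by (auto simp: X_def b_def r_def d_def V_def)
  have dims [simp]: "dim_row X = n" "dim_col X = n" "dim_row b = n" "dim_col b = 1"
      "dim_row r = 1" "dim_col r = n" "dim_row d = 1" "dim_col d = 1" "dim_row V = n" "dim_col V = 1"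
      "dim_row G = n" "dim_col G = n"
    using carrier G(1) by auto
  define Y where "Y = four_block_mat X (- b) (- r) d"
  \<comment> \<open>The last column, \<open>adj(x - A) B\<close> above \<open>c\<close>, is chosen
    so that \<open>X * V\<close> cancels \<open>c\<close> times \<open>b\<close>.\<close>
  define Z where "Z = four_block_mat (1\<^sub>m n) V (0\<^sub>m 1 n) (c \<cdot>\<^sub>m 1\<^sub>m 1)"
  have Y: "char_poly_matrix (four_block_mat A B C D) = Y"
    unfolding Y_def using A B C D
    by (intro eq_matI) (auto simp: char_poly_matrix_def X_def b_def r_def d_def)
  have "X * V = c \<cdot>\<^sub>m b"
    using G carrier
    by (simp add: V_def mult_mat_assoc_dim[symmetric] mult_smult_assoc_mat[of _ n n _ 1])
  then have XV: "X * V + - b * (c \<cdot>\<^sub>m 1\<^sub>m 1) = 0\<^sub>m n 1"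
    using carrier by (simp add: mult_smult_distrib[of _ n 1 _ 1]) (intro eq_matI; simp)
  have "Y * Z = four_block_mat X (0\<^sub>m n 1) (- r) (- r * V + d * (c \<cdot>\<^sub>m 1\<^sub>m 1))"
    unfolding Y_def Z_def
    by (subst four_block_mat_mult_dim) (use XV in \<open>auto intro!: cong_four_block_mat eq_matI\<close>)
  then have "det (Y * Z) = det X * det (- r * V + d * (c \<cdot>\<^sub>m 1\<^sub>m 1))"
    by (simp only:) (rule det_four_block_mat_upper_right_zero[of _ n _ 1]; auto intro!: carrier_matI)
  also have "det (- r * V + d * (c \<cdot>\<^sub>m 1\<^sub>m 1)) = (- r * V + d * (c \<cdot>\<^sub>m 1\<^sub>m 1)) $$ (0, 0)"
    using carrier by (intro det_single) auto
  also have "\<dots> = [:- D $$ (0, 0), 1:] * c - (r * V) $$ (0, 0)"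
    by (simp add: scalar_prod_def d_def algebra_simps)
  also have "(r * V) $$ (0, 0) = resolvent_moment A B C 0"
  proof -
    have "const_mat (C * A ^\<^sub>m 0) = r"
      using A C by (simp add: r_def)
    then have "resolvent_moment A B C 0 = (r * G * b) $$ (0, 0)"
      by (simp add: resolvent_moment_def b_def G_def X_def)
    also have "r * G * b = r * V"
      unfolding V_def by (rule mult_mat_assoc_dim) simp_all
    finally show ?thesis by simp
  qed
  finally have "det (Y * Z) = c * ([:- D $$ (0, 0), 1:] * c - resolvent_moment A B C 0)"
    by (simp add: X_def c_def char_poly_def)
  moreover have "det (Y * Z) = det Y * det Z"
    by (rule det_mult[of _ "n + 1"]) (auto simp: Y_def Z_def intro!: carrier_matI)
  moreover have "det Z = c"
    unfolding Z_def using carrier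
    by (subst det_four_block_mat_lower_left_zero[of _ n _ 1]) auto
  moreover have "c \<noteq> 0"
    using degree_monic_char_poly[OF A] by (auto simp: c_def)
  ultimately show ?thesis
    by (simp add: char_poly_def[of "four_block_mat A B C D"] Y c_def mult.commute)
qed

section \<open>Evaluation at the eigenvalues and conclusion\<close>

lemma char_poly_eq_linear_factors:
  fixes A :: "complex mat"
  assumes "A \<in> carrier_mat n n" "mset xs = eigenvalues_mset A"
  shows "char_poly A = linear_factors xs"
proof -
  have "char_poly A = (\<Prod>x\<in>#proots (char_poly A). [:- x, 1:])"
    using complex_poly_decompose_multiset[of "char_poly A"] degree_monic_char_poly[OF assms(1)] by simp
  also have "proots (char_poly A) = mset xs"
    using assms(2) by (simp add: eigenvalues_mset_def)
  finally show ?thesis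
    by (simp add: linear_factors_def flip: mset_map prod_mset_prod_list)
qed

lemma poly_linear_factors: "poly (linear_factors xs) x = (\<Prod>a\<leftarrow>xs. x - a)"
  by (induction xs) (simp_all add: algebra_simps)

theorem theorem19:
  fixes n :: nat and \<tau> :: "complex mat"
  assumes "\<tau> \<in> carrier_mat (n + 1) (n + 1)"
  shows "Delta n \<tau> = 2 ^ n * (- 1) ^ (n * (n - 1) div 2) * Delta0 n \<tau>"
proof -
  define A B C d where "A = upper_left n \<tau>" and "B = last_col n \<tau>" and "C = last_row n \<tau>"
    and "d = corner n \<tau>"
  have carrier: "A \<in> carrier_mat n n" "B \<in> carrier_mat n 1" "C \<in> carrier_mat 1 n"
      "d \<in> carrier_mat 1 1"
    by (auto simp: A_def B_def C_def d_def intro!: carrier_matI)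
  have \<tau>_block: "\<tau> = four_block_mat A B C d"
    unfolding A_def B_def C_def d_def by (rule bordered_block_decomp[OF assms])
  obtain xs where xs: "mset xs = eigenvalues_mset A"
    using ex_mset by blast
  obtain ys where ys: "mset ys = eigenvalues_mset \<tau>"
    using ex_mset by blast
  have len: "length xs = n" "length ys = n + 1"
    using size_eigenvalues_mset[OF carrier(1)] size_eigenvalues_mset[OF assms]
    by (simp_all flip: xs ys)
  have char_A: "char_poly A = linear_factors xs"
    by (rule char_poly_eq_linear_factors[OF carrier(1) xs])
  have char_\<tau>: "char_poly \<tau> = linear_factors ys"
    by (rule char_poly_eq_linear_factors[OF assms ys])
  define h where "h = bordered_moment n \<tau>"
  define R where "R = resolvent_moment A B C"
  have step: "pCons 0 (R k) - R (Suc k) = Polynomial.smult (h k) (linear_factors xs)" for k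
    using resolvent_moment_step[OF carrier(1-3)]
    by (simp add: R_def h_def bordered_moment_def A_def B_def C_def flip: char_A)
  obtain N where bound: "\<And>k. degree (R k) \<le> N"
    using resolvent_moment_degree_bounded[OF carrier(1-3)] by (auto simp: R_def)
  have cofactor: "seq_functional h (linear_factors (take k xs @ drop (Suc k) xs)) = poly (R 0) (xs ! k)"
    if "k < n" for k
  proof (rule seq_functional_cofactor[OF _ bound])
    have "linear_factors xs = linear_factors (take k xs @ xs ! k # drop (Suc k) xs)"
      using that len by (simp add: id_take_nth_drop[symmetric])
    also have "\<dots> = [:- (xs ! k), 1:] * linear_factors (take k xs @ drop (Suc k) xs)"
      by (simp only: linear_factors_simps mult.left_commute)
    finally show "pCons 0 (R j) - R (Suc j)
        = Polynomial.smult (h j) ([:- (xs ! k), 1:] * linear_factors (take k xs @ drop (Suc k) xs))" for j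
      using step[of j] by simp
  qed
  \<comment> \<open>At a root of \<open>char_poly A\<close> the bordered formula leaves
    \<open>- R 0\<close>. Reversing \<open>n + 1\<close> differences gives
    \<open>(-1)^(n + 1)\<close>, and the two signs combine to \<open>(-1)^n\<close>.\<close>
  have root: "(\<Prod>l\<leftarrow>ys. l - x) = (- 1) ^ n * poly (R 0) x" if "x \<in> set xs" for x
  proof -
    have "poly (char_poly A) x = 0"
      using that by (auto simp: char_A poly_linear_factors prod_list_zero_iff)
    then have "poly (R 0) x = - poly (char_poly \<tau>) x"
      using char_poly_bordered[OF carrier] by (simp add: R_def flip: \<tau>_block)
    also have "poly (char_poly \<tau>) x = (\<Prod>l\<leftarrow>ys. x - l)"
      by (simp add: char_\<tau> poly_linear_factors)
    also have "\<dots> = (- 1) ^ length ys * (\<Prod>l\<leftarrow>ys. l - x)"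
      by (induction ys) (simp_all add: algebra_simps)
    finally have "poly (R 0) x = (- 1) ^ n * (\<Prod>l\<leftarrow>ys. l - x)"
      by (simp add: len)
    then show ?thesis
      by (simp flip: mult.assoc power_mult_distrib)
  qed
  have "Delta0 n \<tau> = (\<Prod>x\<in>#mset xs. \<Prod>l\<in>#mset ys. l - x)"
    unfolding Delta0_def A_def[symmetric] xs[symmetric] ys[symmetric] by (rule prod_mset.swap)
  also have "\<dots> = (\<Prod>x\<leftarrow>xs. \<Prod>l\<leftarrow>ys. l - x)"
    by (simp flip: mset_map prod_mset_prod_list)
  also have "\<dots> = (\<Prod>x\<leftarrow>xs. (- 1) ^ n * poly (R 0) x)"
    using root by (intro arg_cong[where f = prod_list] map_cong) auto
  also have "\<dots> = (\<Prod>k<n. (- 1) ^ n * poly (R 0) (xs ! k))"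
    by (simp add: prod.list_conv_set_nth len atLeast0LessThan)
  \<comment> \<open>The sign occurs \<open>n\<close> times, and \<open>n * n\<close> has the parity
    of \<open>n\<close>.\<close>
  also have "\<dots> = (- 1) ^ n * (\<Prod>k<n. poly (R 0) (xs ! k))"
    by (simp add: prod.distrib minus_one_power_iff flip: power_mult)
  finally have Delta0: "Delta0 n \<tau> = \<dots>" .
  have "det (hankel_mat n h)
      = (- 1) ^ (n * (n - 1) div 2) * (\<Prod>k<n. poly (R 0) (xs ! k))"
  proof -
    have "det (hankel_mat n h) = (- 1) ^ (n * (n - 1) div 2) *
        (\<Prod>k<n. seq_functional h (linear_factors (take k xs @ drop (Suc k) xs)))"
      using det_hankel[of h xs] seq_functional_annihilator[where R = R and h = h, OF step bound]
      by (simp only: len)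
    also have "(\<Prod>k<n. seq_functional h (linear_factors (take k xs @ drop (Suc k) xs)))
        = (\<Prod>k<n. poly (R 0) (xs ! k))"
      by (intro prod.cong refl cofactor) simp
    finally show ?thesis .
  qed
  then have "Delta n \<tau>
      = (- 2) ^ n * ((- 1) ^ (n * (n - 1) div 2) * (\<Prod>k<n. poly (R 0) (xs ! k)))"
    using Delta_eq_det_hankel[OF assms] by (simp add: h_def)
  \<comment> \<open>The \<open>(-1)^n\<close> split off here is the one relating the product of the
    \<open>R 0\<close> values to \<open>Delta0\<close>.\<close>
  also have "(- 2 :: complex) ^ n = 2 ^ n * (- 1) ^ n"
    by (simp flip: power_mult_distrib)
  finally show ?thesis
    by (simp add: Delta0)
qed

end
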